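(* In the ad-hoc radio network model with transmission acknowledgements (defined in the context), there is a deterministic protocol such that, for every acyclic directed graph $G$ with $n$ vertices, labels from $\{0,1,\dots,n-1\}$, and a designated target node $t$ reachable from all other nodes, the protocol completes information gathering on $G$ within $O(n\log^2 n)$ time steps.
   Context: Ad-hoc radio network model: the network is a directed graph $G$ on $n$ nodes, each node having a distinct label from $\{0,1,\dots,n-1\}$; nodes know $n$ and their own label, but the topology of $G$ is unknown to them. Time proceeds in synchronous discrete steps $0,1,2,\dots$, and all nodes start simultaneously at step $0$. In each step each node is either transmitting (sending one message) or receiving. If node $u$ transmits in a step, the message reaches all out-neighbors of $u$; a receiving node $v$ receives a message in that step if and only if exactly one in-neighbor of $v$ transmits in that step; otherwise $v$ receives nothing and cannot distinguish a collision from silence. Messages have unbounded size. Acknowledgements: immediately after each of its transmissions, the transmitting node receives a single bit indicating whether that transmission was successfully received by at least one of its out-neighbors (it learns neither which nor how many). A deterministic protocol specifies each node's transmissions as a function of its label, $n$, the messages it has received, and the acknowledgement bits it has received. Information gathering: each node initially holds a unique rumor; there is a designated target node $t$ reachable by directed paths from all nodes; the task is completed when $t$ holds all $n$ rumors. The running time is the number of steps until completion, in the worst case over all such graphs and labelings. *)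

theory Defs
  imports Complex_Main "HOL-Library.Landau_Symbols"
begin

text \<open>
  The $n$ nodes carry distinct labels from $\{0,\dots,n-1\}$, so a node is identified with its
  label and the network is a relation on \<^term>\<open>{..<n}\<close>. Ranging over all such relations
  covers all graphs together with all labelings. The rumor initially held by node \<^term>\<open>v\<close> is
  identified with \<^term>\<open>v\<close>.

  A message carries a set of rumors, and besides these an arbitrary finite amount of further data.
\<close>

datatype message = Message (rumors: "nat set") (content: "nat list")

datatype action = Receive | Transmit message

text \<open>What a node learns in one step; \<open>Silence\<close> covers both silence and collision.\<close>

datatype observation = Silence | Received message | Ack bool

text \<open>
  A deterministic protocol maps $n$, the label of a node and the node's observations so far
  (oldest first, one per elapsed step) to the action of the node in the next step.
\<close>

type_synonym protocol = "nat \<Rightarrow> nat \<Rightarrow> observation list \<Rightarrow> action"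

definition held :: "nat \<Rightarrow> observation list \<Rightarrow> nat set" where
  "held v h = insert v (\<Union>{rumors m |m. Received m \<in> set h})"

text \<open>
  Rumors are opaque: a node can only pass on rumors it holds, so any other rumors are dropped from
  the message chosen by the protocol. In the following definitions \<^term>\<open>H\<close> assigns to every
  node its observations so far.
\<close>

definition sent :: "protocol \<Rightarrow> nat \<Rightarrow> (nat \<Rightarrow> observation list) \<Rightarrow> nat \<Rightarrow> message option" where
  "sent P n H v = (case P n v (H v) of
      Receive \<Rightarrow> None
    | Transmit m \<Rightarrow> Some (Message (rumors m \<inter> held v (H v)) (content m)))"

definition transmits :: "protocol \<Rightarrow> nat \<Rightarrow> (nat \<Rightarrow> observation list) \<Rightarrow> nat \<Rightarrow> bool" where
  "transmits P n H v \<longleftrightarrow> sent P n H v \<noteq> None"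

text \<open>The transmission of \<^term>\<open>u\<close> is successfully received by \<^term>\<open>v\<close>.\<close>

definition delivers ::
  "protocol \<Rightarrow> nat \<Rightarrow> (nat \<times> nat) set \<Rightarrow> (nat \<Rightarrow> observation list) \<Rightarrow> nat \<Rightarrow> nat \<Rightarrow> bool" where
  "delivers P n E H u v \<longleftrightarrow>
     \<not> transmits P n H v \<and> {w. (w, v) \<in> E \<and> transmits P n H w} = {u}"

definition observe ::
  "protocol \<Rightarrow> nat \<Rightarrow> (nat \<times> nat) set \<Rightarrow> (nat \<Rightarrow> observation list) \<Rightarrow> nat \<Rightarrow> observation" where
  "observe P n E H v =
     (if transmits P n H v then Ack (\<exists>w. delivers P n E H v w)
      else if \<exists>u. delivers P n E H u v
        then Received (the (sent P n H (THE u. delivers P n E H u v)))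
      else Silence)"

text \<open>The observations of every node during the first \<^term>\<open>k\<close> steps.\<close>

primrec history :: "protocol \<Rightarrow> nat \<Rightarrow> (nat \<times> nat) set \<Rightarrow> nat \<Rightarrow> nat \<Rightarrow> observation list" where
  "history P n E 0 = (\<lambda>v. [])"
| "history P n E (Suc k) =
     (\<lambda>v. history P n E k v @ [observe P n E (history P n E k) v])"

definition gathers_within ::
  "protocol \<Rightarrow> nat \<Rightarrow> (nat \<times> nat) set \<Rightarrow> nat \<Rightarrow> nat \<Rightarrow> bool" where
  "gathers_within P n E t T \<longleftrightarrow> (\<exists>k\<le>T. {..<n} \<subseteq> held t (history P n E k t))"

definition acyclic_network :: "nat \<Rightarrow> (nat \<times> nat) set \<Rightarrow> nat \<Rightarrow> bool" where
  "acyclic_network n E t \<longleftrightarrow>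
     E \<subseteq> {..<n} \<times> {..<n} \<and> acyclic E \<and> t < n \<and> (\<forall>v<n. (v, t) \<in> E\<^sup>*)"

end

theory Submission
  imports "HOL-Library.Log_Nat" "HOL-Probability.Product_PMF" Defs
begin

text \<open>
  Let every node transmit alone twice, so that each node learns its in-neighbours and theirs. Call
  \<open>v\<close> a nearest out-neighbour of \<open>u\<close> if no in-neighbour of \<open>v\<close> is an out-neighbour of \<open>u\<close>; by
  acyclicity one exists for every \<open>u\<close> other than \<open>t\<close>. An out-neighbour of \<open>u\<close> can refuse a message
  of \<open>u\<close> by transmitting itself, and such a refusal never disturbs a nearest out-neighbour. Hence an
  acknowledgement tells \<open>u\<close> whether a nearest out-neighbour with prescribed low-order label bits
  exists, and \<open>u\<close> finds the label of one of them, its parent, bit by bit in \<open>O(log n)\<close> queries.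

  The parents form a tree towards \<open>t\<close> in which every node knows its children. A node becomes active
  when it has heard all its children and sends all it holds until its parent has received it;
  here too every other receiver refuses, so that an acknowledgement can only come from the
  parent. Whenever exactly one active node transmits, it succeeds. A union bound over all ways in
  which activity periods can be arranged shows that some fixed sequence of \<open>O(n log\<^sup>2 n)\<close>
  transmission sets, drawn at random with random density, isolates the active nodes one after the
  other on every network.
\<close>

subsection \<open>Random subsets\<close>

definition random_subset :: "'a set \<Rightarrow> real \<Rightarrow> 'a set pmf" where
  "random_subset V p = map_pmf (\<lambda>f. {x \<in> V. f x}) (Pi_pmf V False (\<lambda>_. bernoulli_pmf p))"

lemma prob_random_subset_Int_eq_singleton:
  assumes "finite V" "A \<subseteq> V" "x \<in> A" "0 \<le> p" "p \<le> 1"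
  shows "measure_pmf.prob (random_subset V p) {S. S \<inter> A = {x}} = p * (1 - p) ^ (card A - 1)"
proof -
  define B where "B y = (if y \<in> A then {y = x} else UNIV)" for y
  have prob_B: "measure_pmf.prob (bernoulli_pmf p) (B y) =
      (if y \<in> A then if y = x then p else 1 - p else 1)" for y
    using assms(4,5) by (auto simp: B_def measure_pmf_single)
  have "(\<lambda>f. {y \<in> V. f y}) -` {S. S \<inter> A = {x}} = Pi V B"
    using assms(2,3) by (fastforce simp: B_def Pi_iff)
  then have "measure_pmf.prob (random_subset V p) {S. S \<inter> A = {x}} =
      (\<Prod>y\<in>V. if y \<in> A then if y = x then p else 1 - p else 1)"
    using assms(1) by (simp add: random_subset_def measure_Pi_pmf_Pi prob_B)
  also have "\<dots> = (\<Prod>y\<in>A. if y = x then p else 1 - p)"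
    using assms(1,2) by (simp add: prod.If_cases Int_absorb1)
  also have "\<dots> = p * (1 - p) ^ (card A - 1)"
    using assms finite_subset by (subst prod.remove[of A x]) auto
  finally show ?thesis .
qed

lemma prob_is_singleton_random_subset_Int:
  fixes p :: real
  assumes "finite V" "A \<subseteq> V" "0 \<le> p" "p \<le> 1"
  shows "measure_pmf.prob (random_subset V p) {S. is_singleton (S \<inter> A)} =
    card A * p * (1 - p) ^ (card A - 1)"
proof -
  have "{S. is_singleton (S \<inter> A)} = (\<Union>x\<in>A. {S. S \<inter> A = {x}})"
    by (auto simp: is_singleton_def)
  also have "measure_pmf.prob (random_subset V p) \<dots> =
      (\<Sum>x\<in>A. measure_pmf.prob (random_subset V p) {S. S \<inter> A = {x}})"
    using assms(1,2) finite_subset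
    by (intro measure_pmf.finite_measure_finite_Union) (auto simp: disjoint_family_on_def)
  also have "\<dots> = card A * p * (1 - p) ^ (card A - 1)"
    using assms by (simp add: prob_random_subset_Int_eq_singleton)
  finally show ?thesis .
qed

lemma prob_is_singleton_random_subset_Int_ge:
  fixes p :: real
  assumes "finite V" "A \<subseteq> V" "0 \<le> p" "p \<le> 1" "card A * p \<le> 1 / 2"
  shows "card A * p / 2 \<le> measure_pmf.prob (random_subset V p) {S. is_singleton (S \<inter> A)}"
proof -
  have "real (card A - 1) * p \<le> card A * p" using assms(3) by (intro mult_right_mono) auto
  then have "1 / 2 \<le> 1 - real (card A - 1) * p" using assms(5) by linarith
  also have "\<dots> \<le> (1 - p) ^ (card A - 1)"
    using Bernoulli_inequality[of "- p" "card A - 1"] assms(4) by simp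
  finally have "card A * p * (1 / 2) \<le> card A * p * (1 - p) ^ (card A - 1)"
    using assms(3) by (intro mult_left_mono) auto
  then show ?thesis using assms(1-4) by (simp add: prob_is_singleton_random_subset_Int)
qed

lemma prob_bind_pmf_ge:
  "pmf p x * measure_pmf.prob (f x) A \<le> measure_pmf.prob (bind_pmf p f) A"
proof -
  have "pmf p x * measure_pmf.prob (f x) A =
      measure_pmf.expectation p (\<lambda>y. indicator {x} y * measure_pmf.prob (f x) A)"
    by (simp add: measure_pmf_single)
  also have "\<dots> \<le> measure_pmf.expectation p (\<lambda>y. measure_pmf.prob (f y) A)"
    by (intro integral_mono measure_pmf.integrable_const_bound[where B = 1])
      (auto simp: indicator_def)
  also have "\<dots> = measure_pmf.prob (bind_pmf p f) A"
    unfolding bind_pmf.rep_eq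
    by (simp add: measure_pmf.measure_bind[where N = "count_space UNIV"] measure_subprob)
  finally show ?thesis .
qed

definition random_density_subset :: "'a set \<Rightarrow> nat \<Rightarrow> 'a set pmf" where
  "random_density_subset V l = bind_pmf (pmf_of_set {1..l}) (\<lambda>i. random_subset V (1 / 2 ^ i))"

lemma prob_is_singleton_random_density_subset_Int_ge:
  assumes "finite V" "A \<subseteq> V" "A \<noteq> {}" "2 * card A \<le> 2 ^ l"
  shows "1 / (8 * real l) \<le>
    measure_pmf.prob (random_density_subset V l) {S. is_singleton (S \<inter> A)}"
proof -
  let ?isolating = "{S. is_singleton (S \<inter> A)}"
  have "1 \<le> card A"
    using assms(1-3) finite_subset by (auto simp: Suc_le_eq card_gt_0_iff)
  then obtain j where bracket: "2 ^ j < 2 * card A" "2 * card A \<le> 2 ^ Suc j"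
    using ex_power_ivl2[of 2 "2 * card A"] by auto
  have "2 ^ j < (2 ^ l :: nat)" using bracket(1) assms(4) by (rule less_le_trans)
  then have "Suc j \<in> {1..l}" by simp
  have "real (2 ^ j) < real (2 * card A)" "real (2 * card A) \<le> real (2 ^ Suc j)"
    using bracket by (simp_all only: of_nat_less_iff of_nat_le_iff)
  then have expected: "1 / 4 \<le> card A * (1 / 2 ^ Suc j)" "card A * (1 / 2 ^ Suc j) \<le> 1 / 2"
    by (auto simp: field_simps)
  have density: "(1::real) / 2 ^ Suc j \<le> 1" by (simp add: divide_le_eq_1 del: power_Suc)
  have "1 / 8 \<le> card A * (1 / 2 ^ Suc j) / 2" using expected(1) by simp
  also have "\<dots> \<le> measure_pmf.prob (random_subset V (1 / 2 ^ Suc j)) ?isolating"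
    using assms(1,2) density expected(2) by (intro prob_is_singleton_random_subset_Int_ge) auto
  finally have "1 / (8 * real l) \<le>
      1 / l * measure_pmf.prob (random_subset V (1 / 2 ^ Suc j)) ?isolating"
    using divide_right_mono[of "1 / 8" _ "real l"] by simp
  also have "\<dots> \<le> measure_pmf.prob (random_density_subset V l) ?isolating"
    unfolding random_density_subset_def
    using prob_bind_pmf_ge[of "pmf_of_set {1..l}" "Suc j" "\<lambda>i. random_subset V (1 / 2 ^ i)"]
      \<open>Suc j \<in> {1..l}\<close> by (simp add: pmf_of_set)
  finally show ?thesis .
qed

subsection \<open>Isolating schedules\<close>

lemma prob_Pi_pmf_Pi_le_power:
  assumes "finite I" "0 \<le> c" "c \<le> 1" "m \<le> card {i \<in> I. measure_pmf.prob (p i) (B i) \<le> c}"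
  shows "measure_pmf.prob (Pi_pmf I dflt p) (Pi I B) \<le> c ^ m"
proof -
  have "measure_pmf.prob (Pi_pmf I dflt p) (Pi I B) = (\<Prod>i\<in>I. measure_pmf.prob (p i) (B i))"
    using assms(1) by (rule measure_Pi_pmf_Pi)
  also have "\<dots> \<le> (\<Prod>i\<in>I. if measure_pmf.prob (p i) (B i) \<le> c then c else 1)"
    by (intro prod_mono) auto
  also have "\<dots> = c ^ card {i \<in> I. measure_pmf.prob (p i) (B i) \<le> c}"
    using assms(1) by (simp flip: prod.inter_filter)
  also have "\<dots> \<le> c ^ m"
    using assms(2-4) by (intro power_decreasing)
  finally show ?thesis .
qed

lemma exists_hitting_family:
  fixes p :: "'i \<Rightarrow> 's pmf" and q :: real
  assumes "finite I" "finite C" "0 \<le> q" "q \<le> 1"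
    and likely: "\<And>c. c \<in> C \<Longrightarrow>
      m \<le> card {i \<in> I. q \<le> measure_pmf.prob (p i) {s. hit i s c}}"
    and few: "card C * (1 - q) ^ m < 1"
  obtains S where "\<And>c. c \<in> C \<Longrightarrow> \<exists>i\<in>I. hit i (S i) c"
proof -
  define P where "P = Pi_pmf I undefined p"
  define missing where "missing c = Pi I (\<lambda>i. - {s. hit i s c})" for c
  have prob_missing: "measure_pmf.prob P (missing c) \<le> (1 - q) ^ m" if "c \<in> C" for c
  proof -
    have "measure_pmf.prob (p i) (- {s. hit i s c}) =
        1 - measure_pmf.prob (p i) {s. hit i s c}" for i
      using measure_pmf.prob_compl[of "{s. hit i s c}" "p i"] by (simp add: Compl_eq_Diff_UNIV)
    then show ?thesis
      unfolding P_def missing_def using assms(1,3,4) likely[OF that]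
      by (intro prob_Pi_pmf_Pi_le_power) simp_all
  qed
  have "measure_pmf.prob P (\<Union>c\<in>C. missing c) \<le> (\<Sum>c\<in>C. measure_pmf.prob P (missing c))"
    using assms(2) by (intro measure_UNION_le) auto
  also have "\<dots> \<le> card C * (1 - q) ^ m"
    using prob_missing by (rule sum_bounded_above)
  also have "\<dots> < measure_pmf.prob P UNIV" using few by simp
  finally have "(\<Union>c\<in>C. missing c) \<noteq> UNIV" by auto
  then obtain S where "S \<notin> (\<Union>c\<in>C. missing c)" by blast
  then show ?thesis using that[of S] by (auto simp: missing_def)
qed

definition active :: "'a set \<Rightarrow> ('a \<Rightarrow> nat) \<Rightarrow> ('a \<Rightarrow> nat) \<Rightarrow> nat \<Rightarrow> 'a set" where
  "active V b d k = {v \<in> V. b v \<le> k \<and> k < d v}"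

definition activity_patterns :: "'a set \<Rightarrow> nat \<Rightarrow> (('a \<Rightarrow> nat) \<times> ('a \<Rightarrow> nat)) set" where
  "activity_patterns V N =
    {(b, d) \<in> (V \<rightarrow>\<^sub>E {..Suc N}) \<times> (V \<rightarrow>\<^sub>E {..Suc N}). \<forall>k<N. active V b d k \<noteq> {}}"

lemma activity_patterns_subset:
  "activity_patterns V N \<subseteq> (V \<rightarrow>\<^sub>E {..Suc N}) \<times> (V \<rightarrow>\<^sub>E {..Suc N})"
  by (auto simp: activity_patterns_def)

lemma finite_activity_patterns: "finite V \<Longrightarrow> finite (activity_patterns V N)"
  using activity_patterns_subset by (rule finite_subset) (simp add: finite_PiE)

lemma card_activity_patterns_le:
  assumes "finite V"
  shows "card (activity_patterns V N) \<le> (N + 2) ^ (2 * card V)"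
proof -
  have "card (activity_patterns V N) \<le> card ((V \<rightarrow>\<^sub>E {..Suc N}) \<times> (V \<rightarrow>\<^sub>E {..Suc N}))"
    using assms activity_patterns_subset by (intro card_mono) (simp_all add: finite_PiE)
  then show ?thesis
    using assms by (simp add: card_cartesian_product card_PiE mult_2 power_add)
qed

text \<open>
  \<open>B k\<close> and \<open>D k\<close> are the nodes that have become active and inactive, respectively, by round \<open>k\<close>. A
  node isolated in round \<open>k\<close> is supposed to be inactive from round \<open>k + 1\<close> on; the schedule defeats
  all activity patterns that contradict this.
\<close>

definition isolating_schedule :: "'a set \<Rightarrow> nat \<Rightarrow> (nat \<Rightarrow> 'a set) \<Rightarrow> bool" where
  "isolating_schedule V N S \<longleftrightarrow>
    (\<forall>B D. incseq B \<and> incseq D \<and> (\<forall>k<N. V \<inter> (B k - D k) \<noteq> {}) \<longrightarrow>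
      (\<exists>k<N. \<exists>u. S k \<inter> (V \<inter> (B k - D k)) = {u} \<and> u \<notin> D (Suc k)))"

lemma incseq_entry_times:
  fixes B :: "nat \<Rightarrow> 'a set"
  assumes "incseq B"
  obtains e where "e \<in> V \<rightarrow>\<^sub>E {..Suc N}" "\<And>v k. v \<in> V \<Longrightarrow> k \<le> N \<Longrightarrow> e v \<le> k \<longleftrightarrow> v \<in> B k"
proof
  let ?entry = "\<lambda>v. LEAST k. k = Suc N \<or> v \<in> B k"
  show "restrict ?entry V \<in> V \<rightarrow>\<^sub>E {..Suc N}" by (auto intro: Least_le)
  fix v k assume "v \<in> V" "k \<le> N"
  have "v \<in> B k" if "?entry v \<le> k"
  proof -
    have "?entry v = Suc N \<or> v \<in> B (?entry v)" by (rule LeastI[of _ "Suc N"]) simp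
    then show ?thesis using that \<open>k \<le> N\<close> incseqD[OF assms that] by auto
  qed
  then show "restrict ?entry V v \<le> k \<longleftrightarrow> v \<in> B k"
    using \<open>v \<in> V\<close> by (auto intro: Least_le)
qed

lemma isolating_scheduleI:
  assumes "\<And>b d. (b, d) \<in> activity_patterns V N \<Longrightarrow>
    \<exists>k<N. \<exists>u. S k \<inter> active V b d k = {u} \<and> Suc k < d u"
  shows "isolating_schedule V N S"
  unfolding isolating_schedule_def
proof (intro allI impI, elim conjE)
  fix B D :: "nat \<Rightarrow> 'a set"
  assume "incseq B" "incseq D" and nonempty: "\<forall>k<N. V \<inter> (B k - D k) \<noteq> {}"
  obtain b where entry: "b \<in> V \<rightarrow>\<^sub>E {..Suc N}" "\<And>v k. v \<in> V \<Longrightarrow> k \<le> N \<Longrightarrow> b v \<le> k \<longleftrightarrow> v \<in> B k"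
    using incseq_entry_times[OF \<open>incseq B\<close>, of V N] by blast
  obtain d where exit: "d \<in> V \<rightarrow>\<^sub>E {..Suc N}" "\<And>v k. v \<in> V \<Longrightarrow> k \<le> N \<Longrightarrow> d v \<le> k \<longleftrightarrow> v \<in> D k"
    using incseq_entry_times[OF \<open>incseq D\<close>, of V N] by blast
  have active_eq: "active V b d k = V \<inter> (B k - D k)" if "k < N" for k
    using entry(2)[of _ k] exit(2)[of _ k] that by (force simp: active_def not_le)
  then have "(b, d) \<in> activity_patterns V N"
    using entry(1) exit(1) nonempty by (simp add: activity_patterns_def)
  then obtain k u where "k < N" "S k \<inter> active V b d k = {u}" "Suc k < d u"
    using assms by blast
  moreover from this have "u \<in> V" by (auto simp: active_def)
  ultimately show "\<exists>k<N. \<exists>u. S k \<inter> (V \<inter> (B k - D k)) = {u} \<and> u \<notin> D (Suc k)"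
    using active_eq exit(2)[of u "Suc k"] by (metis Suc_leI not_le)
qed

text \<open>
  A round isolates an active node with probability at least \<open>1 / (8 l)\<close>, and there are fewer than
  \<open>2 ^ (22 n l)\<close> activity patterns. The summand \<open>n\<close> makes up for the rounds after which some node
  becomes inactive.
\<close>

definition schedule_length :: "nat \<Rightarrow> nat \<Rightarrow> nat" where
  "schedule_length n l = n + 176 * n * l\<^sup>2"

lemma schedule_length_less:
  assumes "1 \<le> l" "n \<le> 2 ^ l"
  shows "schedule_length n l + 2 < 2 ^ (11 * l)"
proof -
  have "l\<^sup>2 \<le> (2 ^ l)\<^sup>2" by (intro power_mono) (auto simp: less_imp_le)
  then have "n * l\<^sup>2 \<le> 2 ^ l * (2 ^ l)\<^sup>2" using assms(2) by (intro mult_le_mono)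
  also have "\<dots> = 2 ^ (3 * l)" by (simp flip: power_mult power_add)
  finally have "n * l\<^sup>2 \<le> 2 ^ (3 * l)" .
  moreover have "n \<le> 2 ^ (3 * l)" using assms(2) by (rule order_trans) (simp add: power_increasing)
  moreover have "(1::nat) \<le> 2 ^ (3 * l)" by simp
  ultimately have "schedule_length n l + 2 < 256 * 2 ^ (3 * l)"
    unfolding schedule_length_def mult.assoc by linarith
  also have "\<dots> = 2 ^ (8 + 3 * l)" by (simp add: power_add)
  also have "\<dots> \<le> 2 ^ (11 * l)" using assms(1) by (intro power_increasing) auto
  finally show ?thesis .
qed

lemma card_no_exit_ge:
  assumes "finite V"
  shows "N - card V \<le> card {k \<in> {..<N}. \<forall>v\<in>V. d v \<noteq> Suc k}"
proof -
  have "{..<N} \<subseteq> {k \<in> {..<N}. \<forall>v\<in>V. d v \<noteq> Suc k} \<union> (\<lambda>v. d v - 1) ` V" by force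
  then have "N \<le> card ({k \<in> {..<N}. \<forall>v\<in>V. d v \<noteq> Suc k} \<union> (\<lambda>v. d v - 1) ` V)"
    using assms card_mono[of _ "{..<N}"] by simp
  also have "\<dots> \<le> card {k \<in> {..<N}. \<forall>v\<in>V. d v \<noteq> Suc k} + card ((\<lambda>v. d v - 1) ` V)"
    by (rule card_Un_le)
  also have "card ((\<lambda>v. d v - 1) ` V) \<le> card V" using assms by (rule card_image_le)
  finally show ?thesis by simp
qed

lemma prob_isolate_staying_ge:
  assumes "finite V" "2 * card V \<le> 2 ^ l" "active V b d k \<noteq> {}" "\<forall>v\<in>V. d v \<noteq> Suc k"
  shows "1 / (8 * real l) \<le> measure_pmf.prob (random_density_subset V l)
    {S. \<exists>u. S \<inter> active V b d k = {u} \<and> Suc k < d u}"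
proof -
  have "active V b d k \<subseteq> V" by (auto simp: active_def)
  moreover from this have "2 * card (active V b d k) \<le> 2 ^ l"
    using assms(1,2) card_mono by (meson le_trans mult_le_mono2)
  moreover have "{S. \<exists>u. S \<inter> active V b d k = {u} \<and> Suc k < d u} =
      {S. is_singleton (S \<inter> active V b d k)}"
    using assms(4) unfolding is_singleton_def active_def by (force intro: le_neq_implies_less)
  ultimately show ?thesis
    using prob_is_singleton_random_density_subset_Int_ge[OF assms(1) _ assms(3)] by simp
qed

lemma card_likely_rounds_ge:
  assumes "finite V" "2 * card V \<le> 2 ^ l" "(b, d) \<in> activity_patterns V N"
  shows "N - card V \<le> card {k \<in> {..<N}. 1 / (8 * real l) \<le>
    measure_pmf.prob (random_density_subset V l)
      {S. \<exists>u. S \<inter> active V b d k = {u} \<and> Suc k < d u}}"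
proof -
  have "active V b d k \<noteq> {}" if "k < N" for k
    using assms(3) that by (simp add: activity_patterns_def)
  then have "card {k \<in> {..<N}. \<forall>v\<in>V. d v \<noteq> Suc k} \<le> card {k \<in> {..<N}. 1 / (8 * real l) \<le>
      measure_pmf.prob (random_density_subset V l)
        {S. \<exists>u. S \<inter> active V b d k = {u} \<and> Suc k < d u}}"
    using prob_isolate_staying_ge[OF assms(1,2)] by (intro card_mono) auto
  then show ?thesis using card_no_exit_ge[OF assms(1), of N d] by (rule le_trans[rotated])
qed

lemma failure_power_le:
  assumes "1 \<le> l"
  shows "(1 - 1 / (8 * real l)) ^ (schedule_length n l - n) \<le> 1 / 2 ^ (22 * n * l)"
proof -
  have "(1 - 1 / (8 * real l)) ^ (176 * n * l\<^sup>2) \<le> exp (- 1 / (8 * real l)) ^ (176 * n * l\<^sup>2)"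
    using assms exp_ge_add_one_self[of "- 1 / (8 * real l)"] by (intro power_mono) auto
  also have "\<dots> = exp (- 1) ^ (22 * n * l)"
    using assms by (simp add: power2_eq_square flip: exp_of_nat_mult)
  also have "\<dots> \<le> (1 / 2) ^ (22 * n * l)"
    using exp_ge_add_one_self[of 1] by (intro power_mono) (auto simp: exp_minus field_simps)
  finally show ?thesis by (simp add: schedule_length_def power_one_over)
qed

lemma card_activity_patterns_less:
  assumes "finite V" "V \<noteq> {}" "1 \<le> l" "card V \<le> 2 ^ l"
  shows "card (activity_patterns V (schedule_length (card V) l)) < 2 ^ (22 * card V * l)"
proof -
  have "card (activity_patterns V (schedule_length (card V) l)) \<le>
      (schedule_length (card V) l + 2) ^ (2 * card V)"
    using assms(1) by (rule card_activity_patterns_le)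
  also have "\<dots> < (2 ^ (11 * l)) ^ (2 * card V)"
    using schedule_length_less[OF assms(3,4)] assms(1,2)
    by (intro power_strict_mono) (auto simp: card_gt_0_iff)
  also have "\<dots> = 2 ^ (22 * card V * l)" by (simp add: algebra_simps flip: power_mult)
  finally show ?thesis .
qed

lemma exists_isolating_schedule:
  assumes "finite V" "V \<noteq> {}" "2 * card V \<le> 2 ^ l"
  obtains S where "isolating_schedule V (schedule_length (card V) l) S"
proof -
  define N where "N = schedule_length (card V) l"
  define hit where "hit k S = (\<lambda>(b, d). \<exists>u. S \<inter> active V b d k = {u} \<and> Suc k < d u)" for k S
  have "1 \<le> card V" using assms(1,2) by (simp add: Suc_le_eq card_gt_0_iff)
  then have l_pos: "1 \<le> l" using assms(3) by (cases l) auto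
  have "card (activity_patterns V N) * (1 - 1 / (8 * real l)) ^ (N - card V) \<le>
      card (activity_patterns V N) * (1 / 2 ^ (22 * card V * l))"
    unfolding N_def using failure_power_le[OF l_pos] by (intro mult_left_mono) auto
  also have "\<dots> < 1"
  proof -
    have "real (card (activity_patterns V N)) < real (2 ^ (22 * card V * l))"
      unfolding of_nat_less_iff N_def
      using assms by (intro card_activity_patterns_less l_pos) auto
    then show ?thesis by simp
  qed
  finally have few: "card (activity_patterns V N) * (1 - 1 / (8 * real l)) ^ (N - card V) < 1" .
  have likely: "N - card V \<le> card {k \<in> {..<N}. 1 / (8 * real l) \<le>
      measure_pmf.prob (random_density_subset V l) {S. hit k S c}}"
    if "c \<in> activity_patterns V N" for c
    using card_likely_rounds_ge[OF assms(1,3)] that by (cases c) (simp add: hit_def)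
  obtain S where "\<And>c. c \<in> activity_patterns V N \<Longrightarrow> \<exists>k\<in>{..<N}. hit k (S k) c"
    by (rule exists_hitting_family[OF finite_lessThan finite_activity_patterns _ _ likely few])
      (use assms(1) l_pos in auto)
  then have "isolating_schedule V N S"
    by (intro isolating_scheduleI) (force simp: hit_def)
  then show ?thesis using that by (simp add: N_def)
qed

subsection \<open>Nearest out-neighbours and parent trees\<close>

definition nearest :: "('a \<times> 'a) set \<Rightarrow> 'a \<Rightarrow> 'a \<Rightarrow> bool" where
  "nearest E u v \<longleftrightarrow> (u, v) \<in> E \<and> (\<forall>w. (u, w) \<in> E \<longrightarrow> (w, v) \<notin> E)"

lemma exists_nearest:
  assumes "wf E" "(u, w) \<in> E"
  obtains v where "nearest E u v"
proof -
  obtain v where "v \<in> {v. (u, v) \<in> E}" "\<And>w. (w, v) \<in> E \<Longrightarrow> w \<notin> {v. (u, v) \<in> E}"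
    using wfE_min[OF assms(1), of w "{v. (u, v) \<in> E}"] assms(2) by auto
  then show ?thesis using that by (auto simp: nearest_def)
qed

lemma parent_edges_reach_root:
  assumes "wf (E\<inverse>)" "\<And>u. u \<in> V \<Longrightarrow> u \<noteq> t \<Longrightarrow> (u, p u) \<in> E \<and> p u \<in> V" "y \<in> V"
  shows "(y, t) \<in> {(u, v) \<in> E. p u = v}\<^sup>*"
  using assms(1,3)
proof (induction y rule: wf_induct_rule)
  case (less y)
  show ?case
  proof (cases "y = t")
    case False
    then have "(y, p y) \<in> {(u, v) \<in> E. p u = v}" "(p y, t) \<in> {(u, v) \<in> E. p u = v}\<^sup>*"
      using assms(2)[OF less.prems] less.IH by auto
    then show ?thesis by (rule converse_rtrancl_into_rtrancl)
  qed simp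
qed

subsection \<open>Bitwise search\<close>

definition bits_value :: "(nat \<Rightarrow> bool) \<Rightarrow> nat \<Rightarrow> nat" where
  "bits_value zero j = (\<Sum>i<j. if zero i then 0 else 2 ^ i)"

lemma exists_take_bit_eq_bits_value:
  assumes "\<exists>v. Q v"
    and "\<And>i. i < j \<Longrightarrow> zero i \<longleftrightarrow> (\<exists>v. Q v \<and> take_bit (Suc i) v = bits_value zero i)"
  shows "\<exists>v. Q v \<and> take_bit j v = bits_value zero j"
  using assms(2)
proof (induction j)
  case 0
  then show ?case using assms(1) by (simp add: bits_value_def)
next
  case (Suc j)
  then obtain v where match: "Q v" "take_bit j v = bits_value zero j" by auto
  show ?case
  proof (cases "zero j")
    case True
    then show ?thesis using Suc.prems[of j] by (simp add: bits_value_def)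
  next
    case False
    then have "take_bit (Suc j) v \<noteq> take_bit j v" using Suc.prems[of j] match by auto
    then have "take_bit (Suc j) v = bits_value zero (Suc j)"
      using False match(2) by (auto simp: take_bit_Suc_from_most bits_value_def split: if_splits)
    then show ?thesis using match(1) by blast
  qed
qed

subsection \<open>Executions of protocols\<close>

definition receives :: "(nat \<Rightarrow> observation) \<Rightarrow> nat \<Rightarrow> nat list \<Rightarrow> bool" where
  "receives ob k c \<longleftrightarrow> (\<exists>m. ob k = Received m \<and> content m = c)"

lemma receives_cong: "f k = g k \<Longrightarrow> receives f k = receives g k"
  by (simp add: receives_def fun_eq_iff)

locale execution =
  fixes P :: protocol and n :: nat and E :: "(nat \<times> nat) set"
begin

abbreviation "H \<equiv> history P n E"

abbreviation "tx k \<equiv> transmits P n (H k)"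

abbreviation "delivered k \<equiv> delivers P n E (H k)"

definition obs :: "nat \<Rightarrow> nat \<Rightarrow> observation" where
  "obs v k = observe P n E (H k) v"

lemma history_eq_map_obs: "H k v = map (obs v) [0..<k]"
  by (induction k) (auto simp: obs_def)

lemma tx_iff: "tx k v \<longleftrightarrow> P n v (H k v) \<noteq> Receive"
  by (simp add: transmits_def sent_def split: action.splits)

lemma deliveredD:
  assumes "delivered k u v"
  shows "(u, v) \<in> E" "tx k u" "\<not> tx k v" "\<And>x. (x, v) \<in> E \<Longrightarrow> tx k x \<Longrightarrow> x = u"
  using assms by (auto simp: delivers_def)

lemma deliveredI:
  assumes "(u, v) \<in> E" "tx k u" "\<not> tx k v" "\<And>x. (x, v) \<in> E \<Longrightarrow> tx k x \<Longrightarrow> x = u"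
  shows "delivered k u v"
  unfolding delivers_def using assms by blast

lemma obs_received_iff:
  "obs v k = Received m \<longleftrightarrow> (\<exists>u m'. delivered k u v \<and> P n u (H k u) = Transmit m' \<and>
    m = Message (rumors m' \<inter> held u (H k u)) (content m'))"
proof (cases "\<exists>u. delivered k u v")
  case True
  then obtain u where delivery: "delivered k u v" by blast
  then have "delivered k x v \<longleftrightarrow> x = u" for x by (auto simp: delivers_def)
  moreover have "\<not> tx k v" using delivery by (rule deliveredD)
  moreover obtain m' where "P n u (H k u) = Transmit m'"
    using deliveredD(2)[OF delivery] by (cases "P n u (H k u)") (auto simp: tx_iff)
  ultimately show ?thesis by (auto simp: obs_def observe_def sent_def)
next
  case False
  then show ?thesis by (auto simp: obs_def observe_def)
qed

lemma receives_obs_iff: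
  "receives (obs v) k c \<longleftrightarrow> (\<exists>u m. delivered k u v \<and> P n u (H k u) = Transmit m \<and> content m = c)"
  unfolding receives_def obs_received_iff by fastforce

lemma obs_ack_iff: "obs v k = Ack b \<longleftrightarrow> tx k v \<and> (b \<longleftrightarrow> (\<exists>w. delivered k v w))"
  by (auto simp: obs_def observe_def)

end

subsection \<open>The protocol\<close>

text \<open>
  In the first \<open>2 n\<close> steps the nodes introduce themselves one by one, twice; the second time they
  list their in-neighbours. All later steps form rounds of two steps: some nodes transmit a request
  in the first step and repeat it in the second, while the nodes that received something
  unacceptable refuse by transmitting, too. In round \<open>query_round n j u\<close> node \<open>u\<close> tests whether bit
  \<open>j\<close> of its parent can be 0, or announces its parent if \<open>j = ceillog2 n\<close>. From round
  \<open>search_rounds n\<close> on rumors are sent to parents.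

  The argument \<open>ob\<close> maps each step to the observation made in it.
\<close>

definition slot :: "nat \<Rightarrow> nat \<Rightarrow> nat" where
  "slot n r = 2 * n + 2 * r"

definition query_round :: "nat \<Rightarrow> nat \<Rightarrow> nat \<Rightarrow> nat" where
  "query_round n j u = j * n + u"

definition search_rounds :: "nat \<Rightarrow> nat" where
  "search_rounds n = Suc (ceillog2 n) * n"

definition gather_rounds :: "nat \<Rightarrow> nat" where
  "gather_rounds n = schedule_length n (Suc (ceillog2 n))"

definition gather_schedule :: "nat \<Rightarrow> nat \<Rightarrow> nat set" where
  "gather_schedule n = (SOME S. isolating_schedule {..<n} (gather_rounds n) S)"

definition running_time :: "nat \<Rightarrow> nat" where
  "running_time n = slot n (search_rounds n + gather_rounds n)"

text \<open>The first conjunct rules out acknowledged refusals.\<close>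

definition acknowledged :: "nat \<Rightarrow> (nat \<Rightarrow> observation) \<Rightarrow> nat \<Rightarrow> bool" where
  "acknowledged n ob r \<longleftrightarrow> (\<exists>b. ob (slot n r) = Ack b) \<and> ob (Suc (slot n r)) = Ack True"

definition candidate :: "nat \<Rightarrow> nat \<Rightarrow> (nat \<Rightarrow> observation) \<Rightarrow> nat \<Rightarrow> nat" where
  "candidate n u ob = bits_value (\<lambda>j. acknowledged n ob (query_round n j u))"

definition seems_nearest :: "nat \<Rightarrow> (nat \<Rightarrow> observation) \<Rightarrow> nat \<Rightarrow> bool" where
  "seems_nearest n ob u \<longleftrightarrow>
    (\<exists>c. receives ob u c) \<and> (\<forall>w<n. \<forall>c. receives ob (n + w) c \<longrightarrow> u \<notin> set c)"

definition ready :: "nat \<Rightarrow> nat \<Rightarrow> (nat \<Rightarrow> observation) \<Rightarrow> nat \<Rightarrow> bool" where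
  "ready n v ob r \<longleftrightarrow>
    (\<forall>u<n. receives ob (slot n (query_round n (ceillog2 n) u)) [v] \<longrightarrow>
      (\<exists>i<r. search_rounds n \<le> i \<and> receives ob (slot n i) [u, v]))"

definition finished :: "nat \<Rightarrow> (nat \<Rightarrow> observation) \<Rightarrow> nat \<Rightarrow> bool" where
  "finished n ob r \<longleftrightarrow> (\<exists>i<r. search_rounds n \<le> i \<and> acknowledged n ob i)"

definition introduce :: "nat \<Rightarrow> nat \<Rightarrow> (nat \<Rightarrow> observation) \<Rightarrow> nat \<Rightarrow> action" where
  "introduce n v ob k =
    (if k = v then Transmit (Message {} [])
     else if k = n + v then Transmit (Message {} (filter (\<lambda>u. \<exists>c. receives ob u c) [0..<n]))
     else Receive)"

definition request :: "nat \<Rightarrow> nat \<Rightarrow> (nat \<Rightarrow> observation) \<Rightarrow> nat \<Rightarrow> action" where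
  "request n v ob r =
    (if r < search_rounds n then
       if r mod n = v then Transmit (Message {} [candidate n v ob (r div n)]) else Receive
     else
       if v \<in> gather_schedule n (r - search_rounds n) \<and> ready n v ob r \<and> \<not> finished n ob r
       then Transmit (Message UNIV [v, candidate n v ob (ceillog2 n)]) else Receive)"

definition accepts :: "nat \<Rightarrow> nat \<Rightarrow> (nat \<Rightarrow> observation) \<Rightarrow> nat \<Rightarrow> nat list \<Rightarrow> bool" where
  "accepts n v ob r c \<longleftrightarrow>
    (if r < search_rounds n then seems_nearest n ob (r mod n) \<and> c = [take_bit (Suc (r div n)) v]
     else \<exists>u. c = [u, v])"

definition act :: "nat \<Rightarrow> nat \<Rightarrow> (nat \<Rightarrow> observation) \<Rightarrow> nat \<Rightarrow> action" where
  "act n v ob k =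
    (if k < 2 * n then introduce n v ob k
     else let r = (k - 2 * n) div 2 in
       if odd k \<and> request n v ob r = Receive \<and>
         (\<exists>c. receives ob (slot n r) c \<and> \<not> accepts n v ob r c)
       then Transmit (Message {} []) else request n v ob r)"

definition gather :: protocol where
  "gather n v h = act n v (nth h) (length h)"

lemma query_round_div_mod:
  assumes "u < n"
  shows "query_round n j u div n = j" "query_round n j u mod n = u"
  using assms by (auto simp: query_round_def)

lemma query_round_strict_mono:
  assumes "i < j" "u < n"
  shows "query_round n i u < query_round n j v"
proof -
  have "Suc i * n \<le> j * n" using assms(1) by (intro mult_le_mono1) simp
  then show ?thesis using assms(2) by (simp add: query_round_def)
qed

lemma query_round_less_search_rounds:
  assumes "u < n" "j \<le> ceillog2 n"
  shows "query_round n j u < search_rounds n"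
  using query_round_strict_mono[of j "Suc (ceillog2 n)" u n 0] assms
  by (simp add: query_round_def search_rounds_def)

lemma isolating_schedule_gather_schedule:
  assumes "0 < n"
  shows "isolating_schedule {..<n} (gather_rounds n) (gather_schedule n)"
proof -
  have "2 * card {..<n} \<le> 2 ^ Suc (ceillog2 n)" using le_two_power_ceillog2[of n] by simp
  then obtain S where "isolating_schedule {..<n} (gather_rounds n) S"
    unfolding gather_rounds_def
    using exists_isolating_schedule[of "{..<n}" "Suc (ceillog2 n)"] assms by auto
  then show ?thesis unfolding gather_schedule_def by (rule someI[of "isolating_schedule _ _"])
qed

lemma ready_mono: "ready n v ob r \<Longrightarrow> r \<le> r' \<Longrightarrow> ready n v ob r'"
  unfolding ready_def by (meson less_le_trans)

lemma finished_mono: "finished n ob r \<Longrightarrow> r \<le> r' \<Longrightarrow> finished n ob r'"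
  unfolding finished_def by (meson less_le_trans)

subsubsection \<open>Actions depend on earlier observations only\<close>

lemma acknowledged_cong:
  assumes "\<And>i. i < slot n r \<Longrightarrow> f i = g i" "i < r"
  shows "acknowledged n f i = acknowledged n g i"
  using assms by (simp add: acknowledged_def slot_def)

lemma candidate_cong:
  assumes "\<And>i. i < slot n r \<Longrightarrow> f i = g i" "u < n" "query_round n j u \<le> r"
  shows "candidate n u f j = candidate n u g j"
proof -
  have "acknowledged n f (query_round n i u) = acknowledged n g (query_round n i u)"
    if "i < j" for i
    using assms(3) query_round_strict_mono[OF that assms(2), of u]
    by (intro acknowledged_cong[where r = r] assms(1)) auto
  then show ?thesis by (simp add: candidate_def bits_value_def)
qed

lemma seems_nearest_cong:
  assumes "\<And>i. i < 2 * n \<Longrightarrow> f i = g i" "u < n"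
  shows "seems_nearest n f u = seems_nearest n g u"
  using assms by (simp add: seems_nearest_def receives_def)

lemma ready_cong:
  assumes "\<And>i. i < slot n r \<Longrightarrow> f i = g i" "search_rounds n \<le> r"
  shows "ready n v f r = ready n v g r"
proof -
  have "receives f (slot n i) = receives g (slot n i)" if "i < r" for i
    using that by (intro receives_cong assms(1)) (simp add: slot_def)
  moreover have "query_round n (ceillog2 n) u < r" if "u < n" for u
    using query_round_less_search_rounds[OF that order_refl] assms(2) by (rule less_le_trans)
  ultimately show ?thesis by (simp add: ready_def cong: conj_cong)
qed

lemma finished_cong:
  assumes "\<And>i. i < slot n r \<Longrightarrow> f i = g i"
  shows "finished n f r = finished n g r"
  using acknowledged_cong[OF assms] by (auto simp: finished_def)

lemma request_cong:
  assumes "\<And>i. i < slot n r \<Longrightarrow> f i = g i" "v < n"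
  shows "request n v f r = request n v g r"
proof (cases "r < search_rounds n")
  case True
  have "r mod n = v \<Longrightarrow> candidate n v f (r div n) = candidate n v g (r div n)"
    using assms(2) by (intro candidate_cong[OF assms(1)]) (auto simp: query_round_def)
  then show ?thesis using True by (simp add: request_def)
next
  case False
  then have "query_round n (ceillog2 n) v \<le> r"
    using query_round_less_search_rounds[OF assms(2) order_refl] by simp
  then have "candidate n v f (ceillog2 n) = candidate n v g (ceillog2 n)"
    using assms by (intro candidate_cong)
  moreover have "ready n v f r = ready n v g r" using False assms(1) by (intro ready_cong) auto
  moreover have "finished n f r = finished n g r" using assms(1) by (rule finished_cong)
  ultimately show ?thesis using False by (simp add: request_def)
qed

lemma accepts_cong:
  assumes "\<And>i. i < 2 * n \<Longrightarrow> f i = g i" "0 < n"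
  shows "accepts n v f r = accepts n v g r"
  using seems_nearest_cong[of n f g "r mod n"] assms by (simp add: accepts_def fun_eq_iff)

lemma introduce_cong:
  assumes "\<And>i. i < k \<Longrightarrow> f i = g i" "v < n"
  shows "introduce n v f k = introduce n v g k"
proof -
  have "filter (\<lambda>u. \<exists>c. receives f u c) [0..<n] = filter (\<lambda>u. \<exists>c. receives g u c) [0..<n]"
    if "k = n + v"
    using that by (intro filter_cong) (auto simp: receives_def assms(1))
  then show ?thesis by (simp add: introduce_def)
qed

lemma act_cong:
  assumes "\<And>i. i < k \<Longrightarrow> f i = g i" "v < n"
  shows "act n v f k = act n v g k"
proof (cases "k < 2 * n")
  case True
  then show ?thesis using introduce_cong[OF assms] by (simp add: act_def)
next
  case False
  define r where "r = (k - 2 * n) div 2"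
  have slot_le: "slot n r \<le> k" and slot_less: "odd k \<Longrightarrow> slot n r < k"
    using False by (auto simp: slot_def r_def elim!: oddE)
  have "request n v f r = request n v g r"
    using assms slot_le by (intro request_cong) auto
  moreover have "accepts n v f r = accepts n v g r"
    using assms False by (intro accepts_cong) auto
  moreover have "odd k \<Longrightarrow> receives f (slot n r) = receives g (slot n r)"
    using assms(1) slot_less by (intro receives_cong) blast
  ultimately show ?thesis using False by (auto simp: act_def r_def[symmetric])
qed

subsection \<open>Correctness of the protocol\<close>

locale gather_execution = execution gather n E for n E +
  fixes t :: nat
  assumes network: "acyclic_network n E t"
begin

lemma edge_less: "(u, v) \<in> E \<Longrightarrow> u < n \<and> v < n"
  and target_less: "t < n"
  and path_to_target: "v < n \<Longrightarrow> (v, t) \<in> E\<^sup>*"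
  and acyclic_E: "acyclic E"
  using network by (auto simp: acyclic_network_def)

lemma finite_E: "finite E"
  using network by (auto simp: acyclic_network_def intro: finite_subset)

lemma no_loop: "(v, v) \<notin> E"
  using acyclic_E by (auto simp: acyclic_def)

lemma target_no_out_edge: "(t, v) \<notin> E"
proof
  assume "(t, v) \<in> E"
  then have "(t, t) \<in> E\<^sup>+" using path_to_target edge_less by (meson rtrancl_into_trancl2)
  then show False using acyclic_E by (simp add: acyclic_def)
qed

lemma exists_nearest_neighbour:
  assumes "u < n" "u \<noteq> t"
  obtains v where "nearest E u v"
proof -
  have "(u, t) \<in> E\<^sup>+" using path_to_target[OF assms(1)] assms(2) by (simp add: rtrancl_eq_or_trancl)
  then obtain w where "(u, w) \<in> E" by (meson tranclD)
  then show ?thesis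
    using exists_nearest[OF finite_acyclic_wf[OF finite_E acyclic_E]] that by blast
qed

abbreviation "action_of k v \<equiv> act n v (obs v) k"

abbreviation "request_of r v \<equiv> request n v (obs v) r"

lemma gather_eq_action: "v < n \<Longrightarrow> gather n v (H k v) = action_of k v"
  unfolding gather_def history_eq_map_obs by simp (rule act_cong, auto)

lemma tx_iff_action: "v < n \<Longrightarrow> tx k v \<longleftrightarrow> action_of k v \<noteq> Receive"
  by (simp add: tx_iff gather_eq_action)

lemma acknowledged_obs_iff:
  "acknowledged n (obs v) r \<longleftrightarrow> tx (slot n r) v \<and> (\<exists>w. delivered (Suc (slot n r)) v w)"
  by (auto simp: acknowledged_def obs_ack_iff deliveredD simp del: history.simps)

lemma obs_received_action_iff:
  "obs v k = Received m \<longleftrightarrow> (\<exists>u m'. delivered k u v \<and> action_of k u = Transmit m' \<and>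
    m = Message (rumors m' \<inter> held u (H k u)) (content m'))"
  unfolding obs_received_iff using gather_eq_action edge_less deliveredD(1) by metis

lemma receives_action_iff:
  "receives (obs v) k c \<longleftrightarrow> (\<exists>u m. delivered k u v \<and> action_of k u = Transmit m \<and> content m = c)"
  unfolding receives_obs_iff using gather_eq_action edge_less deliveredD(1) by metis

lemma receives_alone:
  assumes "u < n" "action_of k u = Transmit m" "\<And>x. x < n \<Longrightarrow> x \<noteq> u \<Longrightarrow> action_of k x = Receive"
  shows "receives (obs v) k c \<longleftrightarrow> (u, v) \<in> E \<and> c = content m"
proof -
  have tx: "tx k x \<longleftrightarrow> x = u" if "x < n" for x
    using that assms by (auto simp: tx_iff_action)
  have "delivered k x v \<longleftrightarrow> x = u \<and> (u, v) \<in> E" for x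
  proof
    assume "delivered k x v"
    then show "x = u \<and> (u, v) \<in> E" using tx edge_less deliveredD(1,2) by blast
  next
    assume "x = u \<and> (u, v) \<in> E"
    then show "delivered k x v" using tx edge_less no_loop by (intro deliveredI) blast+
  qed
  then show ?thesis using assms(2) by (auto simp: receives_action_iff)
qed

subsubsection \<open>Introductions\<close>

lemma receives_first_introduction:
  assumes "u < n"
  shows "receives (obs v) u c \<longleftrightarrow> (u, v) \<in> E \<and> c = []"
  using receives_alone[of u u "Message {} []"] assms by (simp add: act_def introduce_def)

lemma receives_second_introduction:
  assumes "w < n"
  shows "receives (obs v) (n + w) c \<longleftrightarrow> (w, v) \<in> E \<and> c = filter (\<lambda>u. (u, w) \<in> E) [0..<n]"
proof -
  have "filter (\<lambda>u. \<exists>c. receives (obs w) u c) [0..<n] = filter (\<lambda>u. (u, w) \<in> E) [0..<n]"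
    by (intro filter_cong) (auto simp: receives_first_introduction)
  then show ?thesis
    using receives_alone[of w "n + w" "Message {} (filter (\<lambda>u. (u, w) \<in> E) [0..<n])"] assms
    by (simp add: act_def introduce_def)
qed

lemma seems_nearest_iff: "u < n \<Longrightarrow> seems_nearest n (obs v) u \<longleftrightarrow> nearest E u v"
  using edge_less
  by (auto simp: seems_nearest_def nearest_def
      receives_first_introduction receives_second_introduction)

subsubsection \<open>Rounds of requests\<close>

lemma action_slot: "action_of (slot n r) v = request_of r v"
  by (simp add: act_def slot_def Let_def)

lemma action_Suc_slot:
  "action_of (Suc (slot n r)) v =
    (if request_of r v = Receive \<and> (\<exists>c. receives (obs v) (slot n r) c \<and> \<not> accepts n v (obs v) r c)
     then Transmit (Message {} []) else request_of r v)"
  by (simp add: act_def slot_def Let_def)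

lemma tx_slot_iff: "v < n \<Longrightarrow> tx (slot n r) v \<longleftrightarrow> request_of r v \<noteq> Receive"
  by (simp only: tx_iff_action action_slot)

lemma tx_Suc_slot_iff:
  "v < n \<Longrightarrow> tx (Suc (slot n r)) v \<longleftrightarrow> tx (slot n r) v \<or>
    (\<exists>c. receives (obs v) (slot n r) c \<and> \<not> accepts n v (obs v) r c)"
  by (auto simp only: tx_iff_action action_slot action_Suc_slot split: if_splits)

lemma receives_sole_request:
  assumes "u < n" "request_of r u = Transmit m" "\<And>x. x < n \<Longrightarrow> x \<noteq> u \<Longrightarrow> request_of r x = Receive"
  shows "receives (obs v) (slot n r) c \<longleftrightarrow> (u, v) \<in> E \<and> c = content m"
  using assms by (intro receives_alone) (simp_all only: action_slot)

lemma acknowledged_imp_accepted: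
  assumes "acknowledged n (obs u) r" "u < n"
  obtains w m where "(u, w) \<in> E" "request_of r u = Transmit m"
    "receives (obs w) (slot n r) (content m)" "accepts n w (obs w) r (content m)"
proof -
  obtain w where tx: "tx (slot n r) u" and delivery: "delivered (Suc (slot n r)) u w"
    using assms(1) unfolding acknowledged_obs_iff by blast
  have "w < n" using deliveredD(1)[OF delivery] edge_less by blast
  then have quiet: "\<not> tx (slot n r) w"
    and accepted: "\<And>c. receives (obs w) (slot n r) c \<Longrightarrow> accepts n w (obs w) r c"
    using deliveredD(3)[OF delivery] tx_Suc_slot_iff by blast+
  obtain m where requested: "request_of r u = Transmit m"
    using tx assms(2) by (cases "request_of r u") (auto simp: tx_slot_iff)
  have "delivered (slot n r) u w"
  proof (rule deliveredI)
    show "x = u" if "(x, w) \<in> E" "tx (slot n r) x" for x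
      using that deliveredD(4)[OF delivery] tx_Suc_slot_iff edge_less by blast
  qed (use deliveredD(1)[OF delivery] tx quiet in auto)
  then have "receives (obs w) (slot n r) (content m)"
    using requested unfolding receives_action_iff action_slot by blast
  then show ?thesis using that[OF deliveredD(1)[OF delivery] requested] accepted by blast
qed

text \<open>Nobody who refuses the request of \<^term>\<open>u\<close> can disturb a nearest out-neighbour of \<^term>\<open>u\<close>.\<close>

lemma sole_request_acknowledged:
  assumes "u < n" "request_of r u = Transmit m" "\<And>x. x < n \<Longrightarrow> x \<noteq> u \<Longrightarrow> request_of r x = Receive"
    and "nearest E u v" "accepts n v (obs v) r (content m)"
  shows "acknowledged n (obs u) r"
proof -
  have out_neighbour: "(u, v) \<in> E" "v < n" "v \<noteq> u" "\<And>x. (x, v) \<in> E \<Longrightarrow> (u, x) \<notin> E"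
    using assms(4) edge_less no_loop unfolding nearest_def by blast+
  have tx: "tx (slot n r) x \<longleftrightarrow> x = u" if "x < n" for x
    using that assms(2,3) by (auto simp: tx_slot_iff)
  have tx_Suc: "tx (Suc (slot n r)) x \<longleftrightarrow>
      x = u \<or> (u, x) \<in> E \<and> \<not> accepts n x (obs x) r (content m)" if "x < n" for x
    using tx_Suc_slot_iff[OF that] tx[OF that] receives_sole_request[OF assms(1-3)] by auto
  have "delivered (Suc (slot n r)) u v"
  proof (rule deliveredI)
    show "x = u" if "(x, v) \<in> E" "tx (Suc (slot n r)) x" for x
      using that out_neighbour(4) tx_Suc edge_less by blast
  qed (use assms(1,5) out_neighbour tx_Suc in blast)+
  then show ?thesis unfolding acknowledged_obs_iff using tx assms(1) by blast
qed

subsubsection \<open>Search for the parents\<close>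

lemma request_query_round:
  assumes "u < n" "j \<le> ceillog2 n"
  shows "request_of (query_round n j u) v =
    (if v = u then Transmit (Message {} [candidate n u (obs u) j]) else Receive)"
  using query_round_less_search_rounds[OF assms]
  by (simp add: request_def query_round_div_mod[OF assms(1)])

lemma accepts_query_round:
  assumes "u < n" "j \<le> ceillog2 n"
  shows "accepts n v (obs v) (query_round n j u) c \<longleftrightarrow>
    nearest E u v \<and> c = [take_bit (Suc j) v]"
  using query_round_less_search_rounds[OF assms]
  by (simp add: accepts_def query_round_div_mod[OF assms(1)] seems_nearest_iff[OF assms(1)])

lemma acknowledged_query_round_iff:
  assumes "u < n" "j \<le> ceillog2 n"
  shows "acknowledged n (obs u) (query_round n j u) \<longleftrightarrow>
    (\<exists>v. nearest E u v \<and> take_bit (Suc j) v = candidate n u (obs u) j)"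
proof
  assume "acknowledged n (obs u) (query_round n j u)"
  then show "\<exists>v. nearest E u v \<and> take_bit (Suc j) v = candidate n u (obs u) j"
    using assms(1)
    by (rule acknowledged_imp_accepted)
      (auto simp: request_query_round[OF assms] accepts_query_round[OF assms])
next
  assume "\<exists>v. nearest E u v \<and> take_bit (Suc j) v = candidate n u (obs u) j"
  then obtain v where "nearest E u v" "take_bit (Suc j) v = candidate n u (obs u) j" by blast
  then show "acknowledged n (obs u) (query_round n j u)"
    using assms(1)
    by (intro sole_request_acknowledged[of u _ "Message {} [candidate n u (obs u) j]" v])
      (auto simp: request_query_round[OF assms] accepts_query_round[OF assms])
qed

definition parent :: "nat \<Rightarrow> nat" where
  "parent u = candidate n u (obs u) (ceillog2 n)"

lemma nearest_parent:
  assumes "u < n" "u \<noteq> t"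
  shows "nearest E u (parent u)"
proof -
  have "\<exists>v. nearest E u v \<and> take_bit (ceillog2 n) v = parent u"
    unfolding parent_def candidate_def
  proof (rule exists_take_bit_eq_bits_value)
    show "\<exists>v. nearest E u v" using exists_nearest_neighbour[OF assms] by blast
    fix j assume "j < ceillog2 n"
    then show "acknowledged n (obs u) (query_round n j u) \<longleftrightarrow> (\<exists>v. nearest E u v \<and>
        take_bit (Suc j) v = bits_value (\<lambda>j. acknowledged n (obs u) (query_round n j u)) j)"
      using acknowledged_query_round_iff[OF assms(1), of j] by (simp add: candidate_def)
  qed
  then obtain v where matching: "nearest E u v" "take_bit (ceillog2 n) v = parent u" by blast
  then have "v < 2 ^ ceillog2 n"
    using edge_less le_two_power_ceillog2[of n] by (auto simp: nearest_def intro: less_le_trans)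
  then show ?thesis using matching by (simp add: take_bit_nat_eq_self)
qed

subsubsection \<open>Gathering along the parent tree\<close>

lemma ready_iff:
  "ready n v (obs v) r \<longleftrightarrow> (\<forall>u. (u, v) \<in> E \<and> parent u = v \<longrightarrow>
    (\<exists>i<r. search_rounds n \<le> i \<and> receives (obs v) (slot n i) [u, v]))"
proof -
  have "receives (obs v) (slot n (query_round n (ceillog2 n) u)) [v] \<longleftrightarrow>
      (u, v) \<in> E \<and> parent u = v" if "u < n" for u
    using that by (subst receives_sole_request[of u]) (auto simp: request_query_round parent_def)
  then show ?thesis using edge_less by (auto simp: ready_def)
qed

lemma request_gathering:
  "search_rounds n \<le> r \<Longrightarrow> request_of r v =
    (if v \<in> gather_schedule n (r - search_rounds n) \<and> ready n v (obs v) r \<and> \<not> finished n (obs v) r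
     then Transmit (Message UNIV [v, parent v]) else Receive)"
  by (simp add: request_def parent_def)

lemma accepts_gathering: "search_rounds n \<le> r \<Longrightarrow> accepts n v (obs v) r c \<longleftrightarrow> (\<exists>u. c = [u, v])"
  by (simp add: accepts_def)

lemma finished_delivered:
  assumes "finished n (obs u) r" "u < n"
  shows "\<exists>i<r. search_rounds n \<le> i \<and> receives (obs (parent u)) (slot n i) [u, parent u]"
proof -
  obtain i where round: "i < r" "search_rounds n \<le> i" "acknowledged n (obs u) i"
    using assms(1) by (auto simp: finished_def)
  obtain w m where "request_of i u = Transmit m"
    and accepted: "receives (obs w) (slot n i) (content m)" "accepts n w (obs w) i (content m)"
    using round(3) assms(2) by (rule acknowledged_imp_accepted)
  then have "content m = [u, parent u]"
    using round(2) by (auto simp: request_gathering split: if_splits)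
  then show ?thesis using accepted round by (auto simp: accepts_gathering)
qed

lemma sole_requester_finished:
  assumes "u < n" "u \<noteq> t" "search_rounds n \<le> r" "request_of r u \<noteq> Receive"
    and "\<And>x. x < n \<Longrightarrow> x \<noteq> u \<Longrightarrow> request_of r x = Receive"
  shows "finished n (obs u) (Suc r)"
proof -
  have "request_of r u = Transmit (Message UNIV [u, parent u])"
    using assms(3,4) by (auto simp: request_gathering split: if_splits)
  then have "acknowledged n (obs u) r"
    using assms(1,3,5) nearest_parent[OF assms(1,2)]
    by (intro sole_request_acknowledged) (auto simp: accepts_gathering)
  then show ?thesis using assms(3) by (auto simp: finished_def)
qed

lemma target_not_finished: "\<not> finished n (obs t) r"
  using target_no_out_edge deliveredD(1) unfolding finished_def acknowledged_obs_iff by blast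

lemma exists_ready_unfinished: "\<exists>v<n. ready n v (obs v) r \<and> \<not> finished n (obs v) r"
proof -
  let ?unfinished = "{v. v < n \<and> \<not> finished n (obs v) r}"
  have "t \<in> ?unfinished" using target_less target_not_finished by simp
  then obtain v where minimal: "v \<in> ?unfinished" "\<And>u. (u, v) \<in> E \<Longrightarrow> u \<notin> ?unfinished"
    by (rule wfE_min[OF finite_acyclic_wf[OF finite_E acyclic_E]]) blast
  then have "ready n v (obs v) r"
    unfolding ready_iff using finished_delivered edge_less by blast
  then show ?thesis using minimal(1) by blast
qed

lemma target_ready:
  "\<exists>k<gather_rounds n. ready n t (obs t) (search_rounds n + k)"
proof -
  define B where "B k = {v. ready n v (obs v) (search_rounds n + k)}" for k
  define D where "D k = {v. finished n (obs v) (search_rounds n + k)}" for k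
  have "incseq B" "incseq D"
    by (auto simp: incseq_def B_def D_def elim: ready_mono finished_mono)
  moreover have "{..<n} \<inter> (B k - D k) \<noteq> {}" for k
    using exists_ready_unfinished[of "search_rounds n + k"] by (auto simp: B_def D_def)
  ultimately obtain k u where "k < gather_rounds n"
    and isolated: "gather_schedule n k \<inter> ({..<n} \<inter> (B k - D k)) = {u}" and "u \<notin> D (Suc k)"
    using isolating_schedule_gather_schedule[of n] target_less
    unfolding isolating_schedule_def by (metis gr_implies_not0 gr0I)
  have request: "request_of (search_rounds n + k) x \<noteq> Receive \<longleftrightarrow> x = u" if "x < n" for x
  proof -
    have "request_of (search_rounds n + k) x \<noteq> Receive \<longleftrightarrow>
        x \<in> gather_schedule n k \<inter> ({..<n} \<inter> (B k - D k))"
      using that by (auto simp: request_gathering B_def D_def)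
    then show ?thesis unfolding isolated by simp
  qed
  have isolated_ready: "u < n" "u \<in> B k" using isolated by auto
  then have "u = t"
    using sole_requester_finished[of u "search_rounds n + k"] request \<open>u \<notin> D (Suc k)\<close>
    by (auto simp: D_def)
  then show ?thesis using isolated_ready(2) \<open>k < gather_rounds n\<close> by (auto simp: B_def)
qed

lemma addressed_request:
  assumes "obs v (slot n r) = Received m" "content m = [u, v]" "search_rounds n \<le> r"
  shows "ready n u (obs u) r" "rumors m = held u (H (slot n r) u)"
proof -
  obtain x m' where "request_of r x = Transmit m'"
    and m_eq: "m = Message (rumors m' \<inter> held x (H (slot n r) x)) (content m')"
    using assms(1) unfolding obs_received_action_iff action_slot by blast
  then have sender: "m' = Message UNIV [x, parent x]" "ready n x (obs x) r"
    using assms(3) by (auto simp: request_gathering split: if_splits)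
  then have "x = u" using assms(2) m_eq by simp
  then show "ready n u (obs u) r" "rumors m = held u (H (slot n r) u)" using m_eq sender by auto
qed

definition tree :: "(nat \<times> nat) set" where
  "tree = {(u, v) \<in> E. parent u = v}"

lemma tree_reaches_target: "v < n \<Longrightarrow> (v, t) \<in> tree\<^sup>*"
  unfolding tree_def
  using nearest_parent edge_less finite_acyclic_wf_converse[OF finite_E acyclic_E]
  by (intro parent_edges_reach_root[of E "{..<n}"]) (auto simp: nearest_def)

lemma ready_holds_subtree:
  assumes "ready n v (obs v) r" "(y, v) \<in> tree\<^sup>*"
  shows "y \<in> held v (H (slot n r) v)"
  using assms
proof (induction r arbitrary: v rule: less_induct)
  case (less r)
  from less.prems(2) show ?case
  proof (cases rule: rtranclE)
    case base
    then show ?thesis by (simp add: held_def)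
  next
    case (step u)
    then have "(u, v) \<in> E" "parent u = v" by (auto simp: tree_def)
    then obtain i m where round: "i < r" "search_rounds n \<le> i"
      and message: "obs v (slot n i) = Received m" "content m = [u, v]"
      using less.prems(1) by (auto simp: ready_iff receives_def)
    note addressed = addressed_request[OF message round(2)]
    have "y \<in> rumors m" using less.IH[OF round(1) addressed(1) step(1)] addressed(2) by simp
    moreover have "Received m \<in> set (H (slot n r) v)"
      unfolding history_eq_map_obs set_map using round(1) message(1)
      by (intro image_eqI[of _ _ "slot n i"]) (auto simp: slot_def)
    ultimately show ?thesis by (auto simp: held_def)
  qed
qed

lemma gathers: "gathers_within gather n E t (running_time n)"
proof -
  obtain k where round: "k < gather_rounds n" "ready n t (obs t) (search_rounds n + k)"
    using target_ready by blast
  have "{..<n} \<subseteq> held t (H (slot n (search_rounds n + k)) t)"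
    using ready_holds_subtree[OF round(2)] tree_reaches_target by auto
  moreover have "slot n (search_rounds n + k) \<le> running_time n"
    using round(1) by (simp add: running_time_def slot_def)
  ultimately show ?thesis unfolding gathers_within_def by blast
qed

end

subsection \<open>Running time\<close>

lemma Suc_ceillog2_bigo: "(\<lambda>n. real (Suc (ceillog2 n))) \<in> O(\<lambda>n. log 2 (real n))"
proof (rule bigoI[where c = 3])
  show "\<forall>\<^sub>F n in sequentially. norm (real (Suc (ceillog2 n))) \<le> 3 * norm (log 2 (real n))"
    using eventually_ge_at_top[of 2]
  proof eventually_elim
    case (elim n)
    then have "1 \<le> log 2 (real n)" by (simp add: le_log_iff)
    then show ?case using ceillog2_less_log[of n] elim unfolding real_norm_def by linarith
  qed
qed

lemma running_time_bigo:
  "(\<lambda>n. real (running_time n)) \<in> O(\<lambda>n. real n * (log 2 (real n))\<^sup>2)"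
proof -
  have "running_time n \<le> 358 * (n * (Suc (ceillog2 n))\<^sup>2)" for n
  proof -
    have "running_time n =
        n * (4 + 2 * Suc (ceillog2 n) + 352 * (Suc (ceillog2 n))\<^sup>2)"
      by (simp add: running_time_def slot_def search_rounds_def gather_rounds_def
          schedule_length_def algebra_simps)
    also have "\<dots> \<le> n * (358 * (Suc (ceillog2 n))\<^sup>2)"
      by (intro mult_le_mono2) (simp add: power2_eq_square)
    finally show ?thesis by simp
  qed
  then have "real (running_time n) \<le> 358 * (real n * (real (Suc (ceillog2 n)))\<^sup>2)" for n
    by (metis of_nat_le_iff of_nat_mult of_nat_numeral of_nat_power)
  then have "(\<lambda>n. real (running_time n)) \<in> O(\<lambda>n. real n * (real (Suc (ceillog2 n)))\<^sup>2)"
    by (intro bigoI[where c = 358] always_eventually) simp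
  also have "(\<lambda>n. real n * (real (Suc (ceillog2 n)))\<^sup>2) \<in> O(\<lambda>n. real n * (log 2 (real n))\<^sup>2)"
    by (intro landau_o.big.mult landau_o.big_power Suc_ceillog2_bigo) simp
  finally show ?thesis .
qed

theorem theorem3:
  "\<exists>(P :: protocol) (T :: nat \<Rightarrow> nat).
     (\<forall>n E t. acyclic_network n E t \<longrightarrow> gathers_within P n E t (T n)) \<and>
     (\<lambda>n. real (T n)) \<in> O(\<lambda>n. real n * (log 2 (real n))\<^sup>2)"
proof (intro exI conjI allI impI)
  fix n E t
  assume "acyclic_network n E t"
  then interpret gather_execution n E t by unfold_locales
  show "gathers_within gather n E t (running_time n)"
    by (rule gathers)
qed (rule running_time_bigo)

end
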